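(* Let $s$ be a positive integer and let $n>2$ be an integer. Let $k_{n,s}$ be the largest index $k\in\{1,\ldots,n\}$ for which the sequence $\{S_s(n,k)\}_{k=1}^{n}$ of Stirling numbers of the first kind with level $s$ assumes its maximum. Then $$\left|k_{n,s}-\sum_{i=1}^{n}\frac{1}{1+(i-1)^s}\right|<1.$$
   Context: For a positive integer $s$, the Stirling numbers of the first kind with level $s$, written $S_s(n,k)$, are defined for integers $0\le k\le n$ by the polynomial identity $$\prod_{i=0}^{n-1}(x+i^s)=\sum_{k=0}^{n}S_s(n,k)\,x^k,\qquad n\ge 0.$$ *)

theory Defs
  imports Complex_Main "HOL-Computational_Algebra.Polynomial"
begin

definition stirling_level :: "nat \<Rightarrow> nat \<Rightarrow> nat \<Rightarrow> nat" where
  "stirling_level s n k = coeff (\<Prod>i<n. [:i ^ s, 1:]) k"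

lemma degree_stirling_level_poly: "degree (\<Prod>i<n. [:(i::nat) ^ s, 1:]) = n"
proof -
  have "degree (\<Prod>i<n. [:(i::nat) ^ s, 1:]) = n \<and> (\<Prod>i<n. [:(i::nat) ^ s, 1:]) \<noteq> 0"
  proof (induction n)
    case (Suc n)
    then have "degree ((\<Prod>i<n. [:(i::nat) ^ s, 1:]) * [:n ^ s, 1:]) = n + 1"
      by (subst degree_mult_eq) auto
    then have "degree (\<Prod>i<Suc n. [:(i::nat) ^ s, 1:]) = Suc n"
      unfolding prod.lessThan_Suc by linarith
    then show ?case
      by (metis degree_0 nat.distinct(1))
  qed simp
  then show ?thesis by simp
qed

text \<open>The defining polynomial identity, which determines the numbers for \<open>k \<le> n\<close>.\<close>

lemma stirling_level_identity:
  "(\<Prod>i<n. [:(i::nat) ^ s, 1:]) = (\<Sum>k\<le>n. monom (stirling_level s n k) k)"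
  unfolding stirling_level_def
  using poly_as_sum_of_monoms[of "\<Prod>i<n. [:(i::nat) ^ s, 1:]"]
  unfolding degree_stirling_level_poly by (rule sym)

text \<open>The index \<open>0\<close> is excluded; the set below is nonempty (so \<open>Max\<close> is meaningful) for \<open>n \<ge> 1\<close>.\<close>

definition stirling_level_mode :: "nat \<Rightarrow> nat \<Rightarrow> nat" where
  "stirling_level_mode s n =
     Max {k \<in> {1..n}. \<forall>j\<in>{1..n}. stirling_level s n j \<le> stirling_level s n k}"

lemma stirling_level_mode_nonempty:
  assumes "n \<ge> 1"
  shows "{k \<in> {1..n}. \<forall>j\<in>{1..n}. stirling_level s n j \<le> stirling_level s n k} \<noteq> {}"
proof -
  have "Max (stirling_level s n ` {1..n}) \<in> stirling_level s n ` {1..n}"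
    using assms by (intro Max_in) auto
  then obtain k where "k \<in> {1..n}" "stirling_level s n k = Max (stirling_level s n ` {1..n})"
    by force
  then show ?thesis by auto
qed

end

theory Submission
  imports Defs
begin

text \<open>
  Darroch's argument. Apart from the factor \<open>x\<close>, the generating polynomial is
  \<open>P = (\<Prod>i\<in>A. (x + a i))\<close> with \<open>a i > 0\<close>. Let \<open>c k\<close> be the coefficients of \<open>P\<close>, \<open>g i k\<close> those
  of \<open>P / (x + a i)\<close>, and \<open>\<mu> = (\<Sum>i\<in>A. 1 / (1 + a i))\<close>. Comparing \<open>P'\<close> with \<open>P\<close> gives
  \<open>(k - \<mu>) * c k = (\<Sum>i\<in>A. a i / (1 + a i) * (g i (k - 1) - g i k))\<close>.
  Since \<open>c k = g i (k - 1) + a i * g i k\<close> and \<open>g i\<close> is strictly log-concave, an ascent of \<open>c\<close>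
  from \<open>k\<close> to \<open>k + 1\<close> forces an ascent of every \<open>g i\<close> from \<open>k - 1\<close> to \<open>k\<close>, hence \<open>k < \<mu>\<close>;
  likewise a descent forces \<open>\<mu> < k + 1\<close>.
\<close>

text \<open>\<open>pCons 0 q\<close> is the polynomial \<open>q\<close> times the variable. Its
  coefficient at \<open>k\<close> stands for that of \<open>q\<close> at \<open>k - 1\<close>, with
  value 0 at \<open>k = 0\<close>, which avoids truncated subtraction here and below.\<close>

lemma coeff_linear_mult:
  fixes q :: "'a::comm_semiring_1 poly"
  shows "coeff ([:b, 1:] * q) k = coeff (pCons 0 q) k + b * coeff q k"
  by (simp add: mult_pCons_left add.commute)

section \<open>Coefficients of products of linear factors: support, sign, log-concavity\<close>

lemma coeff_prod_linear_eq_0: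
  fixes a :: "'i \<Rightarrow> real"
  assumes "finite A" and "card A < k"
  shows "coeff (\<Prod>i\<in>A. [:a i, 1:]) k = 0"
  using assms
proof (induction A arbitrary: k rule: finite_induct)
  case (insert x A)
  then show ?case
    by (cases k) (auto simp: coeff_linear_mult simp del: mult_pCons_left)
qed (auto simp: one_pCons coeff_pCons split: nat.split)

lemma coeff_prod_linear_pos:
  fixes a :: "'i \<Rightarrow> real"
  assumes "finite A" and "\<And>i. i \<in> A \<Longrightarrow> a i > 0" and "k \<le> card A"
  shows "coeff (\<Prod>i\<in>A. [:a i, 1:]) k > 0"
  using assms
proof (induction A arbitrary: k rule: finite_induct)
  case (insert x A)
  let ?q = "\<Prod>i\<in>A. [:a i, 1:]"
  have x: "a x > 0" and pos: "\<And>k. k \<le> card A \<Longrightarrow> coeff ?q k > 0"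
    using insert by auto
  have nonneg: "coeff ?q k \<ge> 0" for k
    using pos[of k] coeff_prod_linear_eq_0[OF insert.hyps(1), where k = k and a = a] by (cases "k \<le> card A") auto
  show ?case
  proof (cases k)
    case 0
    then show ?thesis using insert.hyps x pos[of 0]
      by (simp add: coeff_linear_mult del: mult_pCons_left)
  next
    case (Suc j)
    then have "coeff ?q j > 0" using insert.hyps insert.prems(2) pos by simp
    then show ?thesis using insert.hyps x nonneg[of k] Suc
      by (simp add: coeff_linear_mult add_pos_nonneg del: mult_pCons_left)
  qed
qed simp

lemma coeff_prod_linear_nonneg:
  fixes a :: "'i \<Rightarrow> real"
  assumes "finite A" and "\<And>i. i \<in> A \<Longrightarrow> a i > 0"
  shows "coeff (\<Prod>i\<in>A. [:a i, 1:]) k \<ge> 0"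
  using coeff_prod_linear_pos[where a = a and k = k, OF assms] coeff_prod_linear_eq_0[OF assms(1), where k = k and a = a]
  by (cases "k \<le> card A") auto

text \<open>Multiplying by a factor with positive constant term preserves strict log-concavity. At
  \<open>k = card A\<close> the left side is 0, so the bound is just positivity of the leading
  coefficient.\<close>

lemma coeff_prod_linear_log_concave:
  fixes a :: "'i \<Rightarrow> real"
  assumes "finite A" and "\<And>i. i \<in> A \<Longrightarrow> a i > 0" and "k \<le> card A"
  shows "coeff (pCons 0 (\<Prod>i\<in>A. [:a i, 1:])) k * coeff (\<Prod>i\<in>A. [:a i, 1:]) (Suc k)
           < (coeff (\<Prod>i\<in>A. [:a i, 1:]) k)\<^sup>2"
  using assms
proof (induction A arbitrary: k rule: finite_induct)
  case empty
  then show ?case by simp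
next
  case (insert x A)
  define q where "q = (\<Prod>i\<in>A. [:a i, 1:])"
  define b where "b = a x"
  have b: "b > 0" and aA: "\<And>i. i \<in> A \<Longrightarrow> a i > 0"
    using insert.prems by (auto simp: b_def)
  have zero: "coeff q j = 0" if "j > card A" for j
    unfolding q_def using coeff_prod_linear_eq_0[OF insert.hyps(1) that] .
  have pos: "coeff q j > 0" if "j \<le> card A" for j
    unfolding q_def using coeff_prod_linear_pos[OF insert.hyps(1) aA that] .
  have nonneg: "coeff q j \<ge> 0" for j
    unfolding q_def using coeff_prod_linear_nonneg[OF insert.hyps(1) aA] .
  have slc: "coeff (pCons 0 q) j * coeff q (Suc j) < (coeff q j)\<^sup>2" if "j \<le> card A" for j
    using insert.IH[OF aA that] by (simp add: q_def)
  have lc: "coeff (pCons 0 q) j * coeff q (Suc j) \<le> (coeff q j)\<^sup>2" for j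
    using slc[of j] zero[of "Suc j"] by (cases "j \<le> card A") auto
  have P: "(\<Prod>i\<in>insert x A. [:a i, 1:]) = [:b, 1:] * q"
    using insert.hyps by (simp add: q_def b_def)
  have kA: "k \<le> Suc (card A)" using insert by simp
  show ?case unfolding P
  proof (cases k)
    case 0
    have "b * coeff q 0 \<noteq> 0" using b pos[of 0] by simp
    then show "coeff (pCons 0 ([:b, 1:] * q)) k * coeff ([:b, 1:] * q) (Suc k)
      < (coeff ([:b, 1:] * q) k)\<^sup>2"
      using 0 by (simp add: coeff_linear_mult del: mult_pCons_left)
  next
    case (Suc j)
    \<comment> \<open>Consecutive coefficients of \<open>q\<close>, with \<open>w = 0\<close> if
      \<open>j = 0\<close>. The three coefficients of the new product that matter are
      \<open>w + b * x\<close>, \<open>x + b * y\<close> and \<open>y + b * z\<close>.\<close>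
    define w x y z where "w = coeff (pCons 0 q) j" and "x = coeff q j"
      and "y = coeff q (Suc j)" and "z = coeff q (Suc (Suc j))"
    have x: "x > 0" using pos Suc kA by (simp add: x_def)
    have wy: "w * y < x\<^sup>2" using slc[of j] Suc kA by (simp add: w_def x_def y_def)
    have xz: "x * z \<le> y\<^sup>2" using lc[of "Suc j"] by (simp add: x_def y_def z_def)
    have w: "w \<ge> 0" unfolding w_def using nonneg by (cases j) auto
    have y: "y \<ge> 0" and z: "z \<ge> 0" using nonneg by (auto simp: y_def z_def)
    \<comment> \<open>The cross term: chain the two log-concavity inequalities and cancel
      \<open>x > 0\<close>.\<close>
    have "w * z \<le> x * y"
    proof -
      have "x * (w * z) \<le> w * y\<^sup>2"
        using mult_left_mono[OF xz w] by (simp add: algebra_simps)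
      also have "\<dots> \<le> x\<^sup>2 * y"
        using mult_right_mono[OF less_imp_le[OF wy] y] by (simp add: power2_eq_square algebra_simps)
      finally have "x * (w * z) \<le> x * (x * y)" by (simp add: power2_eq_square algebra_simps)
      then show ?thesis using x by simp
    qed
    then have "b * (w * z) \<le> b * (x * y)" using b by simp
    moreover have "b\<^sup>2 * (x * z) \<le> b\<^sup>2 * y\<^sup>2" using xz by (intro mult_left_mono) auto
    moreover have "0 \<le> b * (x * y)" using b x y by simp
    moreover have "(w + b * x) * (y + b * z) = w * y + b * (x * y) + b * (w * z) + b\<^sup>2 * (x * z)"
      and "(x + b * y)\<^sup>2 = x\<^sup>2 + 2 * (b * (x * y)) + b\<^sup>2 * y\<^sup>2"
      by (auto simp: power2_eq_square algebra_simps)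
    \<comment> \<open>Compare by powers of \<open>b\<close>; strictness comes from the constant term
      \<open>w * y < x\<^sup>2\<close>.\<close>
    ultimately have "(w + b * x) * (y + b * z) < (x + b * y)\<^sup>2"
      using wy by linarith
    then show "coeff (pCons 0 ([:b, 1:] * q)) k * coeff ([:b, 1:] * q) (Suc k)
      < (coeff ([:b, 1:] * q) k)\<^sup>2"
      using Suc by (simp add: coeff_linear_mult w_def x_def y_def z_def del: mult_pCons_left)
  qed
qed

section \<open>Mode against mean for products of linear factors\<close>

lemma coeff_prod_linear_mean:
  fixes a :: "'i \<Rightarrow> real"
  assumes "finite A" and "\<And>i. i \<in> A \<Longrightarrow> a i > 0"
  shows "(real k - (\<Sum>i\<in>A. 1 / (1 + a i))) * coeff (\<Prod>i\<in>A. [:a i, 1:]) k =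
         (\<Sum>i\<in>A. a i / (1 + a i) * (coeff (pCons 0 (\<Prod>j\<in>A - {i}. [:a j, 1:])) k
                                   - coeff (\<Prod>j\<in>A - {i}. [:a j, 1:]) k))"
proof -
  let ?P = "\<Prod>i\<in>A. [:a i, 1:]" and ?g = "\<lambda>i. \<Prod>j\<in>A - {i}. [:a j, 1:]"
  have "pderiv ?P = (\<Sum>i\<in>A. ?g i)"
    by (simp add: pderiv_prod pderiv_pCons)
  then have deriv: "real k * coeff ?P k = (\<Sum>i\<in>A. coeff (pCons 0 (?g i)) k)"
    using coeff_pderiv[of ?P] by (cases k) (simp_all add: coeff_sum)
  \<comment> \<open>The identity already holds for each \<open>i\<close> separately, by splitting
    off the factor of index \<open>i\<close> from \<open>?P\<close>.\<close>
  have "coeff (pCons 0 (?g i)) k - 1 / (1 + a i) * coeff ?P k =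
        a i / (1 + a i) * (coeff (pCons 0 (?g i)) k - coeff (?g i) k)" if "i \<in> A" for i
  proof -
    have "?P = [:a i, 1:] * ?g i"
      using assms(1) that by (simp add: prod.remove)
    then have "coeff ?P k = coeff (pCons 0 (?g i)) k + a i * coeff (?g i) k"
      by (simp only: coeff_linear_mult)
    moreover have "1 + a i \<noteq> 0" using assms(2)[OF that] by simp
    ultimately show ?thesis by (simp add: field_simps)
  qed
  then have "(\<Sum>i\<in>A. coeff (pCons 0 (?g i)) k - 1 / (1 + a i) * coeff ?P k) =
        (\<Sum>i\<in>A. a i / (1 + a i) * (coeff (pCons 0 (?g i)) k - coeff (?g i) k))"
    by (intro sum.cong) auto
  then show ?thesis
    by (simp add: sum_subtractf deriv left_diff_distrib sum_distrib_right)
qed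

lemma prod_linear_ascent_mean:
  fixes a :: "'i \<Rightarrow> real"
  assumes A: "finite A" and a: "\<And>i. i \<in> A \<Longrightarrow> a i > 0" and k: "k < card A"
    and asc: "coeff (\<Prod>i\<in>A. [:a i, 1:]) k \<le> coeff (\<Prod>i\<in>A. [:a i, 1:]) (Suc k)"
  shows "real k < (\<Sum>i\<in>A. 1 / (1 + a i))"
proof -
  let ?P = "\<Prod>i\<in>A. [:a i, 1:]" and ?g = "\<lambda>i. \<Prod>j\<in>A - {i}. [:a j, 1:]"
  have "a i / (1 + a i) * (coeff (pCons 0 (?g i)) k - coeff (?g i) k) < 0" if i: "i \<in> A" for i
  proof -
    define u v w where "u = coeff (pCons 0 (?g i)) k" and "v = coeff (?g i) k"
      and "w = coeff (?g i) (Suc k)"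
    have kc: "k \<le> card (A - {i})" using i k by simp
    have P: "?P = [:a i, 1:] * ?g i" using A i by (simp add: prod.remove)
    have le: "u + a i * v \<le> v + a i * w"
      using asc unfolding P coeff_linear_mult by (simp add: u_def v_def w_def)
    have v: "v > 0" unfolding v_def using A a kc by (intro coeff_prod_linear_pos) auto
    have lc: "u * w < v\<^sup>2" unfolding u_def v_def w_def
      using A a kc by (intro coeff_prod_linear_log_concave) auto
    have "u < v"
    \<comment> \<open>If \<open>v \<le> u\<close>, strict log-concavity gives \<open>w < v\<close>,
      so both parts of \<open>u + a i * v\<close> dominate those of \<open>v + a i * w\<close>, one
      strictly, against \<open>le\<close>.\<close>
    proof (rule ccontr)
      assume "\<not> u < v"
      then have uv: "v \<le> u" by simp
      have "u * w < u * v" using lc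
        unfolding power2_eq_square using mult_right_mono[OF uv, of v] v by linarith
      then have "w < v" using uv v by (simp add: mult_less_cancel_left_pos)
      then have "a i * w < a i * v" using a[OF i] by simp
      then show False using le uv by linarith
    qed
    then show ?thesis unfolding u_def v_def using a[OF i] by (intro mult_pos_neg) auto
  qed
  moreover have "A \<noteq> {}" using k by auto
  ultimately have "(real k - (\<Sum>i\<in>A. 1 / (1 + a i))) * coeff ?P k < 0"
    using A a sum_strict_mono[of A _ "\<lambda>_. 0::real"] by (simp add: coeff_prod_linear_mean)
  moreover have "coeff ?P k > 0" using A a k by (intro coeff_prod_linear_pos) auto
  ultimately show ?thesis by (simp add: mult_less_0_iff)
qed

lemma prod_linear_descent_mean:
  fixes a :: "'i \<Rightarrow> real"
  assumes A: "finite A" and a: "\<And>i. i \<in> A \<Longrightarrow> a i > 0" and k: "k < card A"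
    and desc: "coeff (\<Prod>i\<in>A. [:a i, 1:]) (Suc k) \<le> coeff (\<Prod>i\<in>A. [:a i, 1:]) k"
  shows "(\<Sum>i\<in>A. 1 / (1 + a i)) < real (Suc k)"
proof -
  let ?P = "\<Prod>i\<in>A. [:a i, 1:]" and ?g = "\<lambda>i. \<Prod>j\<in>A - {i}. [:a j, 1:]"
  \<comment> \<open>The mean identity is now used at \<open>Suc k\<close>, where its summands
    compare \<open>v\<close> with \<open>w\<close> instead of \<open>u\<close> with
    \<open>v\<close>.\<close>
  have "a i / (1 + a i) * (coeff (pCons 0 (?g i)) (Suc k) - coeff (?g i) (Suc k)) > 0"
    if i: "i \<in> A" for i
  proof -
    define u v w where "u = coeff (pCons 0 (?g i)) k" and "v = coeff (?g i) k"
      and "w = coeff (?g i) (Suc k)"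
    have kc: "k \<le> card (A - {i})" using i k by simp
    have P: "?P = [:a i, 1:] * ?g i" using A i by (simp add: prod.remove)
    have le: "v + a i * w \<le> u + a i * v"
      using desc unfolding P coeff_linear_mult by (simp add: u_def v_def w_def)
    have v: "v > 0" unfolding v_def using A a kc by (intro coeff_prod_linear_pos) auto
    have lc: "u * w < v\<^sup>2" unfolding u_def v_def w_def
      using A a kc by (intro coeff_prod_linear_log_concave) auto
    have "w < v"
    proof (rule ccontr)
      assume "\<not> w < v"
      then have vw: "v \<le> w" by simp
      have "u * w < v * w" using lc
        unfolding power2_eq_square using mult_left_mono[OF vw, of v] v by linarith
      then have "u < v" using vw v by (simp add: mult_less_cancel_right_pos)
      moreover have "a i * v \<le> a i * w" using vw a[OF i] by simp
      ultimately show False using le by linarith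
    qed
    then show ?thesis unfolding v_def w_def using a[OF i] by simp
  qed
  moreover have "A \<noteq> {}" using k by auto
  ultimately have "(real (Suc k) - (\<Sum>i\<in>A. 1 / (1 + a i))) * coeff ?P (Suc k) > 0"
    using A a by (subst coeff_prod_linear_mean) (auto intro!: sum_pos)
  moreover have "coeff ?P (Suc k) > 0" using A a k by (intro coeff_prod_linear_pos) auto
  ultimately show ?thesis by (simp add: zero_less_mult_iff)
qed

lemma prod_linear_mode_mean:
  fixes a :: "'i \<Rightarrow> real"
  assumes A: "finite A" and a: "\<And>i. i \<in> A \<Longrightarrow> a i > 0" and m: "m \<le> card A"
    and mode: "\<And>j. j \<le> card A \<Longrightarrow>
      coeff (\<Prod>i\<in>A. [:a i, 1:]) j \<le> coeff (\<Prod>i\<in>A. [:a i, 1:]) m"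
  shows "\<bar>real m - (\<Sum>i\<in>A. 1 / (1 + a i))\<bar> < 1"
proof -
  let ?\<mu> = "\<Sum>i\<in>A. 1 / (1 + a i)"
  have "real m - 1 < ?\<mu>"
  proof (cases m)
    case 0
    \<comment> \<open>At either end of the index range one neighbour of the mode is missing; the
      trivial bounds 0 and \<open>card A\<close> on the mean replace it.\<close>
    have "?\<mu> \<ge> 0" using a by (intro sum_nonneg) (simp add: less_imp_le add_nonneg_nonneg)
    then show ?thesis using 0 by simp
  next
    case (Suc j)
    then show ?thesis using prod_linear_ascent_mean[where a = a and k = j, OF A a] mode[of j] m by simp
  qed
  moreover have "?\<mu> < real m + 1"
  proof (cases "m < card A")
    case True
    then show ?thesis using prod_linear_descent_mean[where a = a and k = m, OF A a] mode[of "Suc m"] by simp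
  next
    case False
    have "?\<mu> \<le> real (card A) * 1"
      using a by (intro sum_bounded_above) (simp add: field_simps add_pos_pos less_imp_le)
    then show ?thesis using False m by simp
  qed
  ultimately show ?thesis by linarith
qed

text \<open>The factor \<open>i = 0\<close> of the defining product is \<open>x\<close> because \<open>s > 0\<close>; it shifts all indices by one.\<close>

lemma stirling_level_eq_coeff:
  assumes "s > 0"
  shows "real (stirling_level s (Suc n) k) =
         coeff (pCons 0 (\<Prod>i=1..n. [:real i ^ s, 1:])) k"
proof (induction n arbitrary: k)
  case 0
  then show ?case using assms
    by (cases k) (auto simp: stirling_level_def coeff_pCons split: nat.split)
next
  case (Suc n)
  let ?q = "\<Prod>i=1..n. [:real i ^ s, 1:]"
  have "stirling_level s (Suc (Suc n)) k =
      coeff ([:Suc n ^ s, 1:] * (\<Prod>i<Suc n. [:i ^ s, 1:])) k"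
    unfolding stirling_level_def by (simp only: prod.lessThan_Suc[of _ "Suc n"] mult.commute)
  also have "\<dots> = (case k of 0 \<Rightarrow> 0 | Suc j \<Rightarrow> stirling_level s (Suc n) j)
      + Suc n ^ s * stirling_level s (Suc n) k"
    unfolding coeff_linear_mult stirling_level_def by (simp only: coeff_pCons)
  finally have "real (stirling_level s (Suc (Suc n)) k) =
      (case k of 0 \<Rightarrow> 0 | Suc j \<Rightarrow> coeff (pCons 0 ?q) j)
      + real (Suc n) ^ s * coeff (pCons 0 ?q) k"
    by (auto simp: Suc.IH split: nat.split)
  also have "\<dots> = coeff ([:real (Suc n) ^ s, 1:] * pCons 0 ?q) k"
    unfolding coeff_linear_mult by (simp only: coeff_pCons)
  also have "[:real (Suc n) ^ s, 1:] * pCons 0 ?q = pCons 0 ([:real (Suc n) ^ s, 1:] * ?q)"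
    by (simp only: mult_pCons_right smult_0_right) simp
  also have "[:real (Suc n) ^ s, 1:] * ?q = (\<Prod>i=1..Suc n. [:real i ^ s, 1:])"
    by (simp only: prod.nat_ivl_Suc' mult.commute)
  finally show ?case .
qed

theorem theorem3:
  fixes s n :: nat
  assumes "s > 0" and "n > 2"
  shows "\<bar>real (stirling_level_mode s n) - (\<Sum>i=1..n. 1 / (1 + (real i - 1) ^ s))\<bar> < 1"
proof -
  obtain N where n: "n = Suc N" using assms(2) by (cases n) auto
  let ?S = "{k \<in> {1..n}. \<forall>j\<in>{1..n}. stirling_level s n j \<le> stirling_level s n k}"
  let ?c = "coeff (\<Prod>i=1..N. [:real i ^ s, 1:])"
  have "Max ?S \<in> ?S"
    using stirling_level_mode_nonempty[of n s] assms(2) by (intro Max_in) auto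
  then have mode: "stirling_level_mode s n \<in> ?S" by (simp only: stirling_level_mode_def)
  \<comment> \<open>The mode is at least 1, so it can be shifted down to an index of the product
    over \<open>1..N\<close>.\<close>
  then obtain m where m: "stirling_level_mode s n = Suc m" "m \<le> N"
    using n by (cases "stirling_level_mode s n") auto
  have "?c j \<le> ?c m" if "j \<le> N" for j
  proof -
    have "stirling_level s n (Suc j) \<le> stirling_level s n (Suc m)"
      using mode m that n by auto
    then have "real (stirling_level s n (Suc j)) \<le> real (stirling_level s n (Suc m))"
      by simp
    then show ?thesis unfolding n stirling_level_eq_coeff[OF assms(1)] by simp
  qed
  then have "\<bar>real m - (\<Sum>i=1..N. 1 / (1 + real i ^ s))\<bar> < 1"
    using m(2) by (intro prod_linear_mode_mean) auto
  \<comment> \<open>The term \<open>i = 1\<close> equals 1 because \<open>0 ^ s = 0\<close>; this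
    extra 1 cancels the index shift of the mode.\<close>
  moreover have "(\<Sum>i=1..n. 1 / (1 + (real i - 1) ^ s)) = 1 + (\<Sum>i=1..N. 1 / (1 + real i ^ s))"
  proof -
    have "(\<Sum>i=1..n. 1 / (1 + (real i - 1) ^ s)) = (\<Sum>i=0..N. 1 / (1 + real i ^ s))"
      unfolding n One_nat_def sum.shift_bounds_cl_Suc_ivl by simp
    then show ?thesis using assms(1) by (simp add: sum.atLeast_Suc_atMost power_0_left)
  qed
  ultimately show ?thesis using m by simp
qed

end
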